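(* Let $\mathbb{P}_{\Delta}$ be a complete simplicial toric variety of dimension $n$, with homogeneous coordinates $z_1,\ldots,z_{n+r}$. Let $V=\{f=0\}\subset\mathbb{P}_{\Delta}$ be a quasi-smooth hypersurface of degree $\alpha\in\mathcal{A}_{n-1}(\mathbb{P}_{\Delta})$. Suppose there are integers $1\leq i_1<\cdots<i_k\leq n+r$ such that (i) there is a regular subsequence $\left\{\frac{\partial f}{\partial z_{i_1}},\dots,\frac{\partial f}{\partial z_{i_k}}\right\}\subset\left\{\frac{\partial f}{\partial z_{1}},\dots,\frac{\partial f}{\partial z_{n+r}}\right\}$; and (ii) there is a radial vector field $R_{i_1,\ldots,i_k}=\sum_{j=1}^{k} a_{i_j}z_{i_j}\frac{\partial}{\partial z_{i_j}}$ such that $i_{R_{i_1,\ldots,i_k}}(df)=\theta(\alpha)\cdot f$, where $\alpha\in\mathcal{A}_{n-1}(\mathbb{P}_{\Delta})$ is the degree of $f$ and $\theta(\alpha)$ is a constant. Now, let $X$ be a quasi-homogeneous vector field in $\mathbb{P}_{\Delta}$ and suppose that, in homogeneous coordinates, $X=X_1+X_2$, where $X_1=\sum_{j=1}^{k} P_{i_j}\frac{\partial}{\partial z_{i_j}}$ leaves $V$ invariant. Then $$X_1 = \sum_{j_1<j_2}P_{j_1,j_2}\left(\frac{\partial f}{\partial z_{i_{j_1}}}\frac{\partial}{\partial z_{i_{j_2}}}-\frac{\partial f}{\partial z_{i_{j_2}}}\frac{\partial}{\partial z_{i_{j_1}}} \right)+\frac{g}{\theta(\alpha)}\sum_{j=1}^{k}a_{i_j}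 z_{i_j} \frac{\partial }{\partial z_{i_j}},$$ where $P_{j_1,j_2},\, g\in\mathbb{C}[z_1,\dots,z_{n+r}]$ are quasi-homogeneous polynomials.
   Context: Toric setting: $\Delta$ is a complete simplicial fan in $N\simeq\mathbb{Z}^n$ with rays $\rho_1,\dots,\rho_{n+r}$, where $n_{\rho_j}$ is the generator of $\rho_j\cap N$; $M=\mathrm{Hom}(N,\mathbb{Z})$; $D_j$ is the torus-invariant Weil divisor corresponding to $\rho_j$. The Weil divisor class group $\mathcal{A}_{n-1}(\mathbb{P}_{\Delta})=\mathbb{Z}^{n+r}/\{(\langle m,n_{\rho_j}\rangle)_j: m\in M\}$ is a finitely generated abelian group of rank $r$. The homogeneous coordinate ring $\mathrm{S}=\mathbb{C}[z_1,\dots,z_{n+r}]$ is graded by $\mathcal{A}_{n-1}(\mathbb{P}_{\Delta})$ with $\deg(z_j)=[D_j]$; $\mathrm{S}_\alpha$ is the graded piece of degree $\alpha$, and its elements are called quasi-homogeneous of degree $\alpha$. $\mathbb{P}_{\Delta}$ is the geometric quotient $(\mathbb{C}^{n+r}\setminus\mathcal{Z})/G$, with $G=\mathrm{Hom}_{\mathbb{Z}}(\mathcal{A}_{n-1}(\mathbb{P}_{\Delta}),\mathbb{C}^* )$ acting by $g\cdot(t_j)=(g([D_j])t_j)$ and $\mathcal{Z}$ the common zero set of the monomials $\prod_{\rho_j\notin\sigma(1)}z_j$, $\sigma\in\Delta$, where $\sigma(1)$ is the set of rays of $\sigma$. Radial vector fields: if complex numbers $a_1,\dots,a_{n+r}$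 satisfy $\sum_j a_jn_{\rho_j}=0$ in $N\otimes\mathbb{C}$, then, with $R=\sum_j a_jz_j\frac{\partial}{\partial z_j}$, for each class $\alpha$ there is a constant $\theta(\alpha)$ such that $i_R(df)=\theta(\alpha)\cdot f$ for every $f\in\mathrm{S}_\alpha$ (Euler formula), where $i_R(df)=R(f)$. Taking $r$ relations among the $n_{\rho_j}$ that are linearly independent over $\mathbb{Z}$ gives $r$ vector fields $R_1,\dots,R_r$ tangent to the orbits of $G$, called the radial vector fields. A quasi-homogeneous vector field of degree $\delta\in\mathcal{A}_{n-1}(\mathbb{P}_{\Delta})$ is a polynomial vector field $\sum_{j=1}^{n+r}P_j\frac{\partial}{\partial z_j}$ with $P_j$ quasi-homogeneous of degree $\delta+\deg(z_j)$. For a quasi-homogeneous polynomial $f$ of degree $\alpha$, the hypersurface $V=\{f=0\}\subset\mathbb{P}_{\Delta}$ has degree $\alpha$; it is quasi-smooth if its tangent cone $\{f=0\}$ on $\mathbb{C}^{n+r}\setminus\mathcal{Z}$ is smooth. A vector field $Y$ in homogeneous coordinates leaves $V$ invariant if $Y(f)=g\cdot f$ for some quasi-homogeneous polynomial $g$. *)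

theory Defs
  imports
    "HOL-Analysis.Analysis"
    "HOL-Algebra.Free_Abelian_Groups"
    "HOL-Algebra.Ideal"
    "HOL-Library.Poly_Mapping"
    "HOL-Library.Function_Algebras"
begin

text \<open>The lattice is \<open>int ^ 'n\<close>, embedded in \<open>real ^ 'n\<close>.\<close>

definition real_vec :: "int ^ 'n \<Rightarrow> real ^ 'n" where
  "real_vec u = (\<chi> i. of_int (u $ i))"

definition complex_vec :: "int ^ 'n \<Rightarrow> complex ^ 'n" where
  "complex_vec u = (\<chi> i. of_int (u $ i))"

definition strongly_convex_rational_cone :: "(real ^ 'n) set \<Rightarrow> bool" where
  "strongly_convex_rational_cone \<sigma> \<longleftrightarrow>
     (\<exists>B. finite B \<and> \<sigma> = convex_cone hull (real_vec ` B)) \<and> \<sigma> \<inter> uminus ` \<sigma> = {0}"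

text \<open>The relation \<open>face_of\<close> of the library also admits the empty set; the faces of a
  cone are its nonempty ones.\<close>

definition fan :: "(real ^ 'n) set set \<Rightarrow> bool" where
  "fan \<Delta> \<longleftrightarrow>
     finite \<Delta> \<and>
     (\<forall>\<sigma>\<in>\<Delta>. strongly_convex_rational_cone \<sigma>) \<and>
     (\<forall>\<sigma>\<in>\<Delta>. \<forall>\<tau>. \<tau> face_of \<sigma> \<and> \<tau> \<noteq> {} \<longrightarrow> \<tau> \<in> \<Delta>) \<and>
     (\<forall>\<sigma>\<in>\<Delta>. \<forall>\<tau>\<in>\<Delta>. (\<sigma> \<inter> \<tau>) face_of \<sigma> \<and> (\<sigma> \<inter> \<tau>) face_of \<tau>)"

definition complete_fan :: "(real ^ 'n) set set \<Rightarrow> bool" where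
  "complete_fan \<Delta> \<longleftrightarrow> fan \<Delta> \<and> \<Union>\<Delta> = UNIV"

definition simplicial_fan :: "(real ^ 'n) set set \<Rightarrow> bool" where
  "simplicial_fan \<Delta> \<longleftrightarrow> fan \<Delta> \<and>
     (\<forall>\<sigma>\<in>\<Delta>. \<exists>B. independent (real_vec ` B) \<and> \<sigma> = convex_cone hull (real_vec ` B))"

definition rays :: "(real ^ 'n) set set \<Rightarrow> (real ^ 'n) set set" where
  "rays \<Delta> = {\<rho>\<in>\<Delta>. dim \<rho> = 1}"

definition ray_generator :: "(real ^ 'n) set \<Rightarrow> int ^ 'n \<Rightarrow> bool" where
  "ray_generator \<rho> u \<longleftrightarrow> {w. real_vec w \<in> \<rho>} = range (\<lambda>k::nat. int k *s u)"

text \<open>\<open>\<rho>\<close> lists the rays of \<open>\<Delta>\<close> as \<open>\<rho> 1, \<dots>, \<rho> s\<close>, without repetition,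
  and \<open>v j\<close> is the primitive generator of \<open>\<rho> j\<close>.\<close>

definition ray_enumeration ::
  "(real ^ 'n) set set \<Rightarrow> nat \<Rightarrow> (nat \<Rightarrow> (real ^ 'n) set) \<Rightarrow> (nat \<Rightarrow> int ^ 'n) \<Rightarrow> bool" where
  "ray_enumeration \<Delta> s \<rho> v \<longleftrightarrow>
     bij_betw \<rho> {1..s} (rays \<Delta>) \<and> (\<forall>j\<in>{1..s}. ray_generator (\<rho> j) (v j))"

text \<open>Torus-invariant Weil divisors are the elements of \<open>free_Abelian_group {1..s}\<close>, with
  \<open>D\<^sub>j = frag_of j\<close>. The characters are the additive maps \<open>m\<close> from the lattice to the
  integers. Divisor classes are cosets, and addition of classes is written
  \<open>\<otimes>\<^bsub>class_group s v\<^esub>\<close>.\<close>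

definition principal_divisors :: "nat \<Rightarrow> (nat \<Rightarrow> int ^ 'n) \<Rightarrow> (nat \<Rightarrow>\<^sub>0 int) set" where
  "principal_divisors s v = {\<Sum>j=1..s. frag_cmul (m (v j)) (frag_of j) | m. Modules.additive m}"

definition class_group :: "nat \<Rightarrow> (nat \<Rightarrow> int ^ 'n) \<Rightarrow> (nat \<Rightarrow>\<^sub>0 int) set monoid" where
  "class_group s v = free_Abelian_group {1..s} Mod principal_divisors s v"

definition divisor_class :: "nat \<Rightarrow> (nat \<Rightarrow> int ^ 'n) \<Rightarrow> (nat \<Rightarrow>\<^sub>0 int) \<Rightarrow> (nat \<Rightarrow>\<^sub>0 int) set" where
  "divisor_class s v D = principal_divisors s v #>\<^bsub>free_Abelian_group {1..s}\<^esub> D"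

text \<open>Polynomials are finitely supported maps from exponents to coefficients; the variable
  \<open>z\<^sub>j\<close> has index \<open>j\<close>. The type allows all natural numbers as indices, and \<open>coord_ring s\<close> is
  the subring of the polynomials in \<open>z\<^sub>1, \<dots>, z\<^sub>s\<close>.\<close>

type_synonym cpoly = "(nat \<Rightarrow>\<^sub>0 nat) \<Rightarrow>\<^sub>0 complex"

definition coord_ring :: "nat \<Rightarrow> cpoly ring" where
  "coord_ring s =
     \<lparr>carrier = {p. \<forall>e\<in>Poly_Mapping.keys p. Poly_Mapping.keys e \<subseteq> {1..s}},
      monoid.mult = (*), one = 1, zero = 0, add = (+)\<rparr>"

definition const_poly :: "complex \<Rightarrow> cpoly" where
  "const_poly c = Poly_Mapping.single 0 c"

definition zvar :: "nat \<Rightarrow> cpoly" where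
  "zvar j = Poly_Mapping.single (Poly_Mapping.single j 1) 1"

text \<open>Where \<open>z\<^sub>j\<close> does not occur in a monomial, the truncated subtraction in the exponent is
  harmless because the coefficient is zero.\<close>

definition partial_deriv :: "nat \<Rightarrow> cpoly \<Rightarrow> cpoly" where
  "partial_deriv j p =
     (\<Sum>e\<in>Poly_Mapping.keys p.
        Poly_Mapping.single (e - Poly_Mapping.single j 1)
          (of_nat (Poly_Mapping.lookup e j) * Poly_Mapping.lookup p e))"

definition eval_poly :: "cpoly \<Rightarrow> (nat \<Rightarrow> complex) \<Rightarrow> complex" where
  "eval_poly p t =
     (\<Sum>e\<in>Poly_Mapping.keys p.
        Poly_Mapping.lookup p e * (\<Prod>j\<in>Poly_Mapping.keys e. t j ^ Poly_Mapping.lookup e j))"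

definition monomial_degree :: "nat \<Rightarrow> (nat \<Rightarrow> int ^ 'n) \<Rightarrow> (nat \<Rightarrow>\<^sub>0 nat) \<Rightarrow> (nat \<Rightarrow>\<^sub>0 int) set" where
  "monomial_degree s v e =
     divisor_class s v
       (\<Sum>j\<in>Poly_Mapping.keys e. frag_cmul (int (Poly_Mapping.lookup e j)) (frag_of j))"

definition graded_piece :: "nat \<Rightarrow> (nat \<Rightarrow> int ^ 'n) \<Rightarrow> (nat \<Rightarrow>\<^sub>0 int) set \<Rightarrow> cpoly set" where
  "graded_piece s v \<alpha> =
     {p \<in> carrier (coord_ring s). \<forall>e\<in>Poly_Mapping.keys p. monomial_degree s v e = \<alpha>}"

definition quasi_homogeneous :: "nat \<Rightarrow> (nat \<Rightarrow> int ^ 'n) \<Rightarrow> cpoly \<Rightarrow> bool" where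
  "quasi_homogeneous s v p \<longleftrightarrow> (\<exists>\<alpha>\<in>carrier (class_group s v). p \<in> graded_piece s v \<alpha>)"

definition regular_sequence :: "('a, 'b) ring_scheme \<Rightarrow> 'a list \<Rightarrow> bool" where
  "regular_sequence R fs \<longleftrightarrow>
     set fs \<subseteq> carrier R \<and>
     (\<forall>l<length fs. \<forall>x\<in>carrier R.
        fs ! l \<otimes>\<^bsub>R\<^esub> x \<in> Idl\<^bsub>R\<^esub> (set (take l fs)) \<longrightarrow> x \<in> Idl\<^bsub>R\<^esub> (set (take l fs))) \<and>
     Idl\<^bsub>R\<^esub> (set fs) \<noteq> carrier R"

text \<open>Affine space is modelled by extensional functions on \<open>{1..s}\<close>. The ray \<open>\<rho> j\<close> belongs
  to \<open>\<sigma>(1)\<close> when it is a face of \<open>\<sigma>\<close>.\<close>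

definition irrelevant_locus ::
  "(real ^ 'n) set set \<Rightarrow> nat \<Rightarrow> (nat \<Rightarrow> (real ^ 'n) set) \<Rightarrow> (nat \<Rightarrow> complex) set" where
  "irrelevant_locus \<Delta> s \<rho> =
     {t \<in> {1..s} \<rightarrow>\<^sub>E UNIV. \<forall>\<sigma>\<in>\<Delta>. (\<Prod>j\<in>{j\<in>{1..s}. \<not> \<rho> j face_of \<sigma>}. t j) = 0}"

definition tangent_cone ::
  "(real ^ 'n) set set \<Rightarrow> nat \<Rightarrow> (nat \<Rightarrow> (real ^ 'n) set) \<Rightarrow> cpoly \<Rightarrow> (nat \<Rightarrow> complex) set" where
  "tangent_cone \<Delta> s \<rho> f =
     {t \<in> ({1..s} \<rightarrow>\<^sub>E UNIV) - irrelevant_locus \<Delta> s \<rho>. eval_poly f t = 0}"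

definition quasi_smooth ::
  "(real ^ 'n) set set \<Rightarrow> nat \<Rightarrow> (nat \<Rightarrow> (real ^ 'n) set) \<Rightarrow> cpoly \<Rightarrow> bool" where
  "quasi_smooth \<Delta> s \<rho> f \<longleftrightarrow>
     (\<forall>t\<in>tangent_cone \<Delta> s \<rho> f. \<exists>j\<in>{1..s}. eval_poly (partial_deriv j f) t \<noteq> 0)"

text \<open>A vector field is the function sending \<open>j\<close> to its coefficient at \<open>\<partial>/\<partial>z\<^sub>j\<close>; sums and
  differences of vector fields are pointwise.\<close>

type_synonym vfield = "nat \<Rightarrow> cpoly"

definition coord_vf :: "nat \<Rightarrow> vfield" where
  "coord_vf j = (\<lambda>l. if l = j then 1 else 0)"

definition vf_scale :: "cpoly \<Rightarrow> vfield \<Rightarrow> vfield"  (infixr \<open>\<odot>\<close> 75) where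
  "p \<odot> X = (\<lambda>l. p * X l)"

text \<open>The function \<open>X(f) = i\<^sub>X(df)\<close>.\<close>

definition vf_apply :: "nat \<Rightarrow> vfield \<Rightarrow> cpoly \<Rightarrow> cpoly" where
  "vf_apply s X f = (\<Sum>j=1..s. X j * partial_deriv j f)"

definition quasi_homogeneous_vf ::
  "nat \<Rightarrow> (nat \<Rightarrow> int ^ 'n) \<Rightarrow> (nat \<Rightarrow>\<^sub>0 int) set \<Rightarrow> vfield \<Rightarrow> bool" where
  "quasi_homogeneous_vf s v \<delta> X \<longleftrightarrow>
     (\<forall>j\<in>{1..s}. X j \<in> graded_piece s v (\<delta> \<otimes>\<^bsub>class_group s v\<^esub> divisor_class s v (frag_of j))) \<and>
     (\<forall>j. j \<notin> {1..s} \<longrightarrow> X j = 0)"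

definition radial_vf :: "nat \<Rightarrow> (nat \<Rightarrow> int ^ 'n) \<Rightarrow> vfield \<Rightarrow> bool" where
  "radial_vf s v R \<longleftrightarrow>
     (\<exists>a. (\<Sum>j=1..s. a j *s complex_vec (v j)) = 0 \<and>
          R = (\<Sum>j=1..s. (const_poly (a j) * zvar j) \<odot> coord_vf j))"

definition leaves_invariant :: "nat \<Rightarrow> (nat \<Rightarrow> int ^ 'n) \<Rightarrow> cpoly \<Rightarrow> vfield \<Rightarrow> bool" where
  "leaves_invariant s v f Y \<longleftrightarrow> (\<exists>g. quasi_homogeneous s v g \<and> vf_apply s Y f = g * f)"

end

theory Submission
  imports Defs
begin

text \<open>
  Write \<open>x\<^sub>j\<close> for the partial derivative of \<open>f\<close> in the direction \<open>i j\<close>, and let \<open>X\<^sub>1(f) = g f\<close>.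
  By the Euler formula the field \<open>Y = X\<^sub>1 - (g / \<theta>(\<alpha>)) R\<close> satisfies
  \<open>Y(f) = g f - (g / \<theta>(\<alpha>)) \<theta>(\<alpha>) f = 0\<close>. Since both \<open>X\<^sub>1\<close> and \<open>R\<close> involve only the directions
  \<open>i j\<close>, this says that the coefficients of \<open>Y\<close> form a syzygy of the sequence \<open>x\<^sub>1, \<dots>, x\<^sub>k\<close>. The
  sequence is regular, so its syzygies are generated by the trivial ones, which express
  \<open>x\<^sub>l x\<^sub>j = x\<^sub>j x\<^sub>l\<close> (\<open>koszul_syzygy\<close>, the exactness of the Koszul complex in degree one). Read as
  vector fields, the trivial syzygies are the fields \<open>x\<^sub>l \<partial>\<^sub>j - x\<^sub>j \<partial>\<^sub>l\<close>, and this is the claim up to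
  homogeneity of the coefficients.

  Homogeneity comes from the grading by the class group. All of \<open>f\<close>, the \<open>x\<^sub>j\<close> and the
  coefficients of \<open>X\<^sub>1\<close> are homogeneous, so every identity used is an identity between homogeneous
  elements and remains true when each unknown coefficient is replaced by its component in the
  expected degree (\<open>homogeneous_part_mult\<close>). This is applied to \<open>g\<close>, whose expected degree is
  \<open>\<delta>\<close>: invariance provides a witness that is homogeneous of some degree, while the degree of \<open>Y\<close>
  has to agree with that of \<open>X\<^sub>1\<close>. It is then applied to the coefficients of the Koszul
  relations (\<open>graded_koszul_syzygy\<close>).
\<close>

section \<open>The divisor class group\<close>

lemma subgroup_principal_divisors:
  "subgroup (principal_divisors s v) (free_Abelian_group {1..s})"
proof (rule group.subgroupI[OF group_free_Abelian_group])
  show "principal_divisors s v \<subseteq> carrier (free_Abelian_group {1..s})"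
  proof
    fix D assume "D \<in> principal_divisors s v"
    then obtain m where D: "D = (\<Sum>j=1..s. frag_cmul (m (v j)) (frag_of j))"
      by (auto simp: principal_divisors_def)
    have "Poly_Mapping.keys (frag_cmul (m (v j)) (frag_of j)) \<subseteq> {1..s}" if "j \<in> {1..s}" for j
      using keys_cmul[of "m (v j)" "frag_of j"] that by auto
    then have "Poly_Mapping.keys D \<subseteq> {1..s}"
      unfolding D using keys_sum[of "\<lambda>j. frag_cmul (m (v j)) (frag_of j)" "{1..s}"] by blast
    then show "D \<in> carrier (free_Abelian_group {1..s})"
      by simp
  qed
  have "0 \<in> principal_divisors s v"
    unfolding principal_divisors_def
    by (rule CollectI, rule exI[of _ "\<lambda>_. 0"]) (simp add: Modules.additive_def)
  then show "principal_divisors s v \<noteq> {}"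
    by blast
next
  fix D assume "D \<in> principal_divisors s v"
  then obtain m where D: "D = (\<Sum>j=1..s. frag_cmul (m (v j)) (frag_of j))" and "Modules.additive m"
    by (auto simp: principal_divisors_def)
  then have "Modules.additive (\<lambda>u. - m u)"
    by (simp add: Modules.additive_def)
  moreover have "inv\<^bsub>free_Abelian_group {1..s}\<^esub> D = - D"
    using D by (intro inv_free_Abelian_group) (auto dest!: subsetD[OF keys_sum] subsetD[OF keys_cmul])
  moreover have "- D = (\<Sum>j=1..s. frag_cmul (- m (v j)) (frag_of j))"
    unfolding D sum_negf[symmetric] by (intro sum.cong refl poly_mapping_eqI) simp
  ultimately show "inv\<^bsub>free_Abelian_group {1..s}\<^esub> D \<in> principal_divisors s v"
    unfolding principal_divisors_def by auto
next
  fix D E assume "D \<in> principal_divisors s v" "E \<in> principal_divisors s v"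
  then obtain m m' where
    D: "D = (\<Sum>j=1..s. frag_cmul (m (v j)) (frag_of j))" "Modules.additive m" and
    E: "E = (\<Sum>j=1..s. frag_cmul (m' (v j)) (frag_of j))" "Modules.additive m'"
    by (auto simp: principal_divisors_def)
  then have "Modules.additive (\<lambda>u. m u + m' u)"
    by (simp add: Modules.additive_def)
  then show "D \<otimes>\<^bsub>free_Abelian_group {1..s}\<^esub> E \<in> principal_divisors s v"
    unfolding principal_divisors_def D E
    by (intro CollectI exI[of _ "\<lambda>u. m u + m' u"]) (auto simp: sum.distrib frag_cmul_distrib)
qed

lemma comm_group_class_group: "comm_group (class_group s v)"
  unfolding class_group_def
  by (intro comm_group.abelian_FactGroup abelian_free_Abelian_group subgroup_principal_divisors)

lemma principal_divisors_normal:
  "principal_divisors s v \<lhd> free_Abelian_group {1..s}"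
  using comm_group.normal_iff_subgroup[OF abelian_free_Abelian_group] subgroup_principal_divisors
  by blast

lemma divisor_class_closed:
  assumes "Poly_Mapping.keys D \<subseteq> {1..s}"
  shows "divisor_class s v D \<in> carrier (class_group s v)"
  using assms by (auto simp: divisor_class_def class_group_def FactGroup_def RCOSETS_def)

lemma divisor_class_add:
  assumes "Poly_Mapping.keys D \<subseteq> {1..s}" "Poly_Mapping.keys E \<subseteq> {1..s}"
  shows "divisor_class s v (D + E) = divisor_class s v D \<otimes>\<^bsub>class_group s v\<^esub> divisor_class s v E"
  using normal.rcos_sum[OF principal_divisors_normal, of D s E v] assms
  by (simp add: divisor_class_def class_group_def)

lemma keys_exponent_divisor:
  assumes "Poly_Mapping.keys e \<subseteq> {1..s}"
  shows "Poly_Mapping.keys (\<Sum>j\<in>Poly_Mapping.keys e.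
      frag_cmul (int (Poly_Mapping.lookup e j)) (frag_of j)) \<subseteq> {1..s}"
  using assms by (auto dest!: subsetD[OF keys_sum] subsetD[OF keys_cmul])

lemma monomial_degree_closed:
  assumes "Poly_Mapping.keys e \<subseteq> {1..s}"
  shows "monomial_degree s v e \<in> carrier (class_group s v)"
  unfolding monomial_degree_def by (intro divisor_class_closed keys_exponent_divisor assms)

lemma keys_add_nat:
  fixes d e :: "'a \<Rightarrow>\<^sub>0 nat"
  shows "Poly_Mapping.keys (d + e) = Poly_Mapping.keys d \<union> Poly_Mapping.keys e"
  by (auto simp: in_keys_iff lookup_add)

lemma monomial_degree_add:
  assumes "Poly_Mapping.keys d \<subseteq> {1..s}" "Poly_Mapping.keys e \<subseteq> {1..s}"
  shows "monomial_degree s v (d + e)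
    = monomial_degree s v d \<otimes>\<^bsub>class_group s v\<^esub> monomial_degree s v e"
proof -
  let ?D = "\<lambda>b :: nat \<Rightarrow>\<^sub>0 nat. \<Sum>j\<in>Poly_Mapping.keys b. frag_cmul (int (Poly_Mapping.lookup b j)) (frag_of j)"
  have D: "?D b = (\<Sum>j=1..s. frag_cmul (int (Poly_Mapping.lookup b j)) (frag_of j))"
    if "Poly_Mapping.keys b \<subseteq> {1..s}" for b
    by (rule sum.mono_neutral_left) (use that in \<open>auto simp: in_keys_iff\<close>)
  have "?D (d + e) = ?D d + ?D e"
    using D[of d] D[of e] D[of "d + e"] assms
    by (simp add: keys_add_nat lookup_add frag_cmul_distrib sum.distrib)
  then show ?thesis
    using divisor_class_add[OF keys_exponent_divisor keys_exponent_divisor, OF assms]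
    by (simp add: monomial_degree_def)
qed

lemma monomial_degree_single:
  "monomial_degree s v (Poly_Mapping.single j 1) = divisor_class s v (frag_of j)"
  by (simp add: monomial_degree_def)

section \<open>The homogeneous coordinate ring and its grading\<close>

lemma carrier_coord_ring_iff:
  "p \<in> carrier (coord_ring s) \<longleftrightarrow> (\<forall>e\<in>Poly_Mapping.keys p. Poly_Mapping.keys e \<subseteq> {1..s})"
  by (simp add: coord_ring_def)

lemma coord_ring_simps:
  "p \<otimes>\<^bsub>coord_ring s\<^esub> q = p * q" "p \<oplus>\<^bsub>coord_ring s\<^esub> q = p + q"
  "\<one>\<^bsub>coord_ring s\<^esub> = 1" "\<zero>\<^bsub>coord_ring s\<^esub> = 0"
  by (simp_all add: coord_ring_def)

lemma coord_ring_closed: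
  "0 \<in> carrier (coord_ring s)"
  "1 \<in> carrier (coord_ring s)"
  "p \<in> carrier (coord_ring s) \<Longrightarrow> - p \<in> carrier (coord_ring s)"
  "p \<in> carrier (coord_ring s) \<Longrightarrow> q \<in> carrier (coord_ring s) \<Longrightarrow> p + q \<in> carrier (coord_ring s)"
  "p \<in> carrier (coord_ring s) \<Longrightarrow> q \<in> carrier (coord_ring s) \<Longrightarrow> p * q \<in> carrier (coord_ring s)"
proof -
  show "0 \<in> carrier (coord_ring s)" "1 \<in> carrier (coord_ring s)"
    by (auto simp: carrier_coord_ring_iff simp flip: single_one)
  show "p \<in> carrier (coord_ring s) \<Longrightarrow> - p \<in> carrier (coord_ring s)"
    by (simp add: carrier_coord_ring_iff)
  show "p \<in> carrier (coord_ring s) \<Longrightarrow> q \<in> carrier (coord_ring s) \<Longrightarrow> p + q \<in> carrier (coord_ring s)"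
    unfolding carrier_coord_ring_iff using keys_add[of p q] by blast
  assume p: "p \<in> carrier (coord_ring s)" and q: "q \<in> carrier (coord_ring s)"
  show "p * q \<in> carrier (coord_ring s)"
    unfolding carrier_coord_ring_iff
  proof
    fix e assume "e \<in> Poly_Mapping.keys (p * q)"
    then obtain b c where "e = b + c" "b \<in> Poly_Mapping.keys p" "c \<in> Poly_Mapping.keys q"
      using keys_mult[of p q] by blast
    then show "Poly_Mapping.keys e \<subseteq> {1..s}"
      using p q by (auto simp: carrier_coord_ring_iff keys_add_nat)
  qed
qed

lemma cring_coord_ring: "cring (coord_ring s)"
proof (rule cringI)
  show "abelian_group (coord_ring s)"
  proof (rule abelian_groupI)
    show "\<exists>y\<in>carrier (coord_ring s). y \<oplus>\<^bsub>coord_ring s\<^esub> x = \<zero>\<^bsub>coord_ring s\<^esub>"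
      if "x \<in> carrier (coord_ring s)" for x
      using that coord_ring_closed(3) by (intro bexI[of _ "- x"]) (simp_all add: coord_ring_simps)
  qed (simp_all add: coord_ring_simps coord_ring_closed algebra_simps)
  show "Group.comm_monoid (coord_ring s)"
    by (rule comm_monoidI) (simp_all add: coord_ring_simps coord_ring_closed algebra_simps)
qed (simp add: coord_ring_simps algebra_simps)

lemma a_inv_coord_ring:
  assumes "p \<in> carrier (coord_ring s)"
  shows "\<ominus>\<^bsub>coord_ring s\<^esub> p = - p"
proof -
  interpret cring "coord_ring s" by (rule cring_coord_ring)
  show ?thesis
    using assms by (intro minus_equality) (simp_all add: coord_ring_closed coord_ring_simps)
qed

lemma coord_ring_sum_closed:
  assumes "\<And>j. j \<in> J \<Longrightarrow> p j \<in> carrier (coord_ring s)"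
  shows "(\<Sum>j\<in>J. p j) \<in> carrier (coord_ring s)"
  using assms by (induction J rule: infinite_finite_induct) (auto simp: coord_ring_closed)

text \<open>
  This turns membership in the ideals that define regularity into the explicit coefficients on
  which the syzygy argument operates.
\<close>

lemma genideal_coord_ring:
  assumes "finite J" and x: "\<And>j. j \<in> J \<Longrightarrow> x j \<in> carrier (coord_ring s)"
  shows "Idl\<^bsub>coord_ring s\<^esub> (x ` J) =
    {\<Sum>j\<in>J. c j * x j | c. \<forall>j\<in>J. c j \<in> carrier (coord_ring s)}" (is "_ = ?I")
proof
  interpret cring "coord_ring s" by (rule cring_coord_ring)
  have "ideal ?I (coord_ring s)"
  proof (rule idealI)
    show "Ring.ring (coord_ring s)"
      by (rule ring_axioms)
    show "subgroup ?I (add_monoid (coord_ring s))"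
    proof (rule add.subgroupI)
      show "?I \<subseteq> carrier (coord_ring s)"
        using x by (auto intro!: coord_ring_sum_closed coord_ring_closed)
      have "0 \<in> ?I"
        by (intro CollectI exI[of _ "\<lambda>_. 0"]) (simp add: coord_ring_closed)
      then show "?I \<noteq> {}"
        by blast
    next
      fix p assume "p \<in> ?I"
      then obtain c where c: "p = (\<Sum>j\<in>J. c j * x j)" "\<forall>j\<in>J. c j \<in> carrier (coord_ring s)"
        by blast
      then have "\<ominus>\<^bsub>coord_ring s\<^esub> p = (\<Sum>j\<in>J. - c j * x j)"
        using x by (subst a_inv_coord_ring)
          (auto simp: sum_negf intro!: coord_ring_sum_closed coord_ring_closed)
      then show "\<ominus>\<^bsub>coord_ring s\<^esub> p \<in> ?I"
        using c by (intro CollectI exI[of _ "\<lambda>j. - c j"]) (simp add: coord_ring_closed)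
    next
      fix p q assume "p \<in> ?I" "q \<in> ?I"
      then obtain c d where "p = (\<Sum>j\<in>J. c j * x j)" "\<forall>j\<in>J. c j \<in> carrier (coord_ring s)"
        "q = (\<Sum>j\<in>J. d j * x j)" "\<forall>j\<in>J. d j \<in> carrier (coord_ring s)"
        by blast
      then show "p \<oplus>\<^bsub>coord_ring s\<^esub> q \<in> ?I"
        by (intro CollectI exI[of _ "\<lambda>j. c j + d j"])
          (simp add: coord_ring_closed coord_ring_simps sum.distrib algebra_simps)
    qed
  next
    fix p q assume "p \<in> ?I" and q: "q \<in> carrier (coord_ring s)"
    then obtain c where "p = (\<Sum>j\<in>J. c j * x j)" "\<forall>j\<in>J. c j \<in> carrier (coord_ring s)"
      by blast
    then have "q * p \<in> ?I"
      using q by (intro CollectI exI[of _ "\<lambda>j. q * c j"])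
        (simp add: coord_ring_closed sum_distrib_left mult.assoc)
    then show "q \<otimes>\<^bsub>coord_ring s\<^esub> p \<in> ?I" "p \<otimes>\<^bsub>coord_ring s\<^esub> q \<in> ?I"
      by (simp_all add: coord_ring_simps mult.commute)
  qed
  moreover have "x l \<in> ?I" if "l \<in> J" for l
    using that \<open>finite J\<close>
    by (intro CollectI exI[of _ "\<lambda>j. if j = l then 1 else 0"])
      (simp add: coord_ring_closed if_distrib[of "\<lambda>c. c * _"] sum.delta cong: if_cong)
  ultimately show "Idl\<^bsub>coord_ring s\<^esub> (x ` J) \<subseteq> ?I"
    by (intro genideal_minimal) auto
  have sub: "x ` J \<subseteq> carrier (coord_ring s)"
    using x by blast
  interpret I: ideal "Idl\<^bsub>coord_ring s\<^esub> (x ` J)" "coord_ring s"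
    by (rule genideal_ideal[OF sub])
  show "?I \<subseteq> Idl\<^bsub>coord_ring s\<^esub> (x ` J)"
  proof
    fix p assume "p \<in> ?I"
    then obtain c where p: "p = (\<Sum>j\<in>J. c j * x j)" and c: "\<forall>j\<in>J. c j \<in> carrier (coord_ring s)"
      by blast
    have "(\<Sum>j\<in>K. c j * x j) \<in> Idl\<^bsub>coord_ring s\<^esub> (x ` J)" if "K \<subseteq> J" for K
      using finite_subset[OF that \<open>finite J\<close>] that
    proof (induction K)
      case empty
      then show ?case
        using I.zero_closed by (simp add: coord_ring_simps)
    next
      case (insert l K)
      have "x l \<in> Idl\<^bsub>coord_ring s\<^esub> (x ` J)"
        using insert.prems genideal_self[OF sub] by blast
      then have "c l * x l \<in> Idl\<^bsub>coord_ring s\<^esub> (x ` J)"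
        using I.I_l_closed[of "x l" "c l"] c insert.prems by (simp add: coord_ring_simps)
      then show ?case
        using I.a_closed insert by (simp add: coord_ring_simps)
    qed
    then show "p \<in> Idl\<^bsub>coord_ring s\<^esub> (x ` J)"
      using p by blast
  qed
qed

definition homogeneous_part ::
  "nat \<Rightarrow> (nat \<Rightarrow> int ^ 'n) \<Rightarrow> (nat \<Rightarrow>\<^sub>0 int) set \<Rightarrow> cpoly \<Rightarrow> cpoly" where
  "homogeneous_part s v \<gamma> p = Poly_Mapping.mapp (\<lambda>e c. if monomial_degree s v e = \<gamma> then c else 0) p"

lemma lookup_homogeneous_part:
  "Poly_Mapping.lookup (homogeneous_part s v \<gamma> p) e =
    (if monomial_degree s v e = \<gamma> then Poly_Mapping.lookup p e else 0)"
  by (simp add: homogeneous_part_def lookup_mapp when_def in_keys_iff)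

lemma keys_homogeneous_part:
  "Poly_Mapping.keys (homogeneous_part s v \<gamma> p) = {e\<in>Poly_Mapping.keys p. monomial_degree s v e = \<gamma>}"
  by (rule Set.set_eqI) (simp add: in_keys_iff lookup_homogeneous_part)

lemma homogeneous_part_in_graded_piece:
  "p \<in> carrier (coord_ring s) \<Longrightarrow> homogeneous_part s v \<gamma> p \<in> graded_piece s v \<gamma>"
  by (simp add: graded_piece_def carrier_coord_ring_iff keys_homogeneous_part)

lemma homogeneous_part_ident:
  assumes "p \<in> graded_piece s v \<gamma>"
  shows "homogeneous_part s v \<gamma> p = p"
proof (rule poly_mapping_eqI)
  fix e
  have "monomial_degree s v e = \<gamma>" if "Poly_Mapping.lookup p e \<noteq> 0"
    using assms that by (simp add: graded_piece_def in_keys_iff)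
  then show "Poly_Mapping.lookup (homogeneous_part s v \<gamma> p) e = Poly_Mapping.lookup p e"
    unfolding lookup_homogeneous_part by presburger
qed

lemma homogeneous_part_add:
  "homogeneous_part s v \<gamma> (p + q) = homogeneous_part s v \<gamma> p + homogeneous_part s v \<gamma> q"
  by (intro poly_mapping_eqI) (simp add: lookup_homogeneous_part lookup_add)

lemma homogeneous_part_diff:
  "homogeneous_part s v \<gamma> (p - q) = homogeneous_part s v \<gamma> p - homogeneous_part s v \<gamma> q"
  by (intro poly_mapping_eqI) (simp add: lookup_homogeneous_part lookup_minus)

lemma homogeneous_part_0: "homogeneous_part s v \<gamma> 0 = 0"
  by (intro poly_mapping_eqI) (simp add: lookup_homogeneous_part)

lemma homogeneous_part_sum:
  "homogeneous_part s v \<gamma> (\<Sum>j\<in>J. p j) = (\<Sum>j\<in>J. homogeneous_part s v \<gamma> (p j))"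
  by (induction J rule: infinite_finite_induct)
    (auto simp: homogeneous_part_0 homogeneous_part_add)

lemma graded_piece_mult:
  assumes p: "p \<in> graded_piece s v \<beta>" and q: "q \<in> graded_piece s v \<gamma>"
  shows "p * q \<in> graded_piece s v (\<beta> \<otimes>\<^bsub>class_group s v\<^esub> \<gamma>)"
  unfolding graded_piece_def
proof (intro CollectI conjI ballI)
  show "p * q \<in> carrier (coord_ring s)"
    using p q by (auto simp: graded_piece_def intro: coord_ring_closed)
  fix e assume "e \<in> Poly_Mapping.keys (p * q)"
  then obtain b c where e: "e = b + c" and b: "b \<in> Poly_Mapping.keys p" and c: "c \<in> Poly_Mapping.keys q"
    using keys_mult[of p q] by blast
  have "Poly_Mapping.keys b \<subseteq> {1..s}" "monomial_degree s v b = \<beta>"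
    using p b by (simp_all add: graded_piece_def carrier_coord_ring_iff)
  moreover have "Poly_Mapping.keys c \<subseteq> {1..s}" "monomial_degree s v c = \<gamma>"
    using q c by (simp_all add: graded_piece_def carrier_coord_ring_iff)
  ultimately show "monomial_degree s v e = \<beta> \<otimes>\<^bsub>class_group s v\<^esub> \<gamma>"
    by (simp add: e monomial_degree_add)
qed

lemma graded_piece_diff:
  assumes "p \<in> graded_piece s v \<gamma>" "q \<in> graded_piece s v \<gamma>"
  shows "p - q \<in> graded_piece s v \<gamma>"
  using assms keys_diff[of p q] unfolding graded_piece_def carrier_coord_ring_iff by blast

lemma graded_piece_sum:
  assumes "\<And>j. j \<in> J \<Longrightarrow> p j \<in> graded_piece s v \<gamma>"
  shows "(\<Sum>j\<in>J. p j) \<in> graded_piece s v \<gamma>"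
  using assms keys_sum[of p J] unfolding graded_piece_def carrier_coord_ring_iff by blast

text \<open>
  Multiplication by a homogeneous \<open>q\<close> shifts degrees by \<open>\<beta>\<close>. As degrees live in a group, the shift
  is injective, so monomials of \<open>p\<close> outside one degree cannot contribute to \<open>p * q\<close> in the
  shifted degree.
\<close>

lemma homogeneous_part_mult:
  assumes p: "p \<in> carrier (coord_ring s)" and q: "q \<in> graded_piece s v \<beta>"
    and \<beta>: "\<beta> \<in> carrier (class_group s v)" and \<gamma>: "\<gamma> \<in> carrier (class_group s v)"
  shows "homogeneous_part s v \<gamma> (p * q) =
    homogeneous_part s v (\<gamma> \<otimes>\<^bsub>class_group s v\<^esub> inv\<^bsub>class_group s v\<^esub> \<beta>) p * q"
proof -
  interpret comm_group "class_group s v" by (rule comm_group_class_group)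
  let ?\<epsilon> = "\<gamma> \<otimes>\<^bsub>class_group s v\<^esub> inv\<^bsub>class_group s v\<^esub> \<beta>"
  define p' where "p' = homogeneous_part s v ?\<epsilon> p"
  have "p' * q \<in> graded_piece s v (?\<epsilon> \<otimes>\<^bsub>class_group s v\<^esub> \<beta>)"
    unfolding p'_def by (intro graded_piece_mult homogeneous_part_in_graded_piece p q)
  also have "?\<epsilon> \<otimes>\<^bsub>class_group s v\<^esub> \<beta> = \<gamma>"
    using \<beta> \<gamma> by (simp add: m_assoc)
  finally have main: "homogeneous_part s v \<gamma> (p' * q) = p' * q"
    by (rule homogeneous_part_ident)
  have "homogeneous_part s v \<gamma> ((p - p') * q) = 0"
  proof (rule ccontr)
    assume "homogeneous_part s v \<gamma> ((p - p') * q) \<noteq> 0"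
    then obtain e where "e \<in> Poly_Mapping.keys ((p - p') * q)" and e: "monomial_degree s v e = \<gamma>"
      by (auto simp: keys_homogeneous_part simp flip: keys_eq_empty)
    then obtain b c where bc: "e = b + c" "b \<in> Poly_Mapping.keys (p - p')" "c \<in> Poly_Mapping.keys q"
      using keys_mult[of "p - p'" q] by blast
    from bc(2) have "b \<in> Poly_Mapping.keys p" and b: "monomial_degree s v b \<noteq> ?\<epsilon>"
      by (auto simp: in_keys_iff lookup_minus p'_def lookup_homogeneous_part split: if_splits)
    then have bs: "Poly_Mapping.keys b \<subseteq> {1..s}"
      using p by (simp add: carrier_coord_ring_iff)
    have "Poly_Mapping.keys c \<subseteq> {1..s}" "monomial_degree s v c = \<beta>"
      using q bc(3) by (simp_all add: graded_piece_def carrier_coord_ring_iff)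
    with bs e bc(1) have "\<gamma> = monomial_degree s v b \<otimes>\<^bsub>class_group s v\<^esub> \<beta>"
      by (simp add: monomial_degree_add)
    then have "?\<epsilon> = monomial_degree s v b"
      using \<beta> monomial_degree_closed[OF bs, of v] by (simp add: m_assoc)
    with b show False
      by simp
  qed
  moreover have "p * q = p' * q + (p - p') * q"
    by (simp add: algebra_simps)
  ultimately show ?thesis
    using main by (simp add: homogeneous_part_add p'_def)
qed

lemma graded_piece_const_mult:
  assumes "p \<in> graded_piece s v \<gamma>"
  shows "const_poly c * p \<in> graded_piece s v \<gamma>"
proof -
  have "Poly_Mapping.keys (const_poly c * p) \<subseteq> Poly_Mapping.keys p"
    using keys_mult[of "const_poly c" p] by (auto simp: const_poly_def split: if_splits)
  then show ?thesis
    using assms unfolding graded_piece_def carrier_coord_ring_iff by blast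
qed

lemma zvar_in_graded_piece:
  assumes "j \<in> {1..s}"
  shows "zvar j \<in> graded_piece s v (divisor_class s v (frag_of j))"
  using assms by (simp add: graded_piece_def carrier_coord_ring_iff zvar_def
      monomial_degree_single del: One_nat_def)

lemma partial_deriv_in_graded_piece:
  assumes f: "f \<in> graded_piece s v \<alpha>" and j: "j \<in> {1..s}"
  shows "partial_deriv j f \<in> graded_piece s v
    (\<alpha> \<otimes>\<^bsub>class_group s v\<^esub> inv\<^bsub>class_group s v\<^esub> divisor_class s v (frag_of j))"
  unfolding partial_deriv_def
proof (rule graded_piece_sum)
  interpret comm_group "class_group s v" by (rule comm_group_class_group)
  let ?z = "Poly_Mapping.single j (1::nat)"
  fix e assume "e \<in> Poly_Mapping.keys f"
  with f have e: "Poly_Mapping.keys e \<subseteq> {1..s}" "monomial_degree s v e = \<alpha>"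
    by (simp_all add: graded_piece_def carrier_coord_ring_iff)
  \<comment> \<open>If \<open>z\<^sub>j\<close> does not divide the monomial, the exponent \<open>e - ?z\<close> is truncated and of the
    wrong degree, but its coefficient vanishes.\<close>
  show "Poly_Mapping.single (e - ?z) (of_nat (Poly_Mapping.lookup e j) * Poly_Mapping.lookup f e)
      \<in> graded_piece s v (\<alpha> \<otimes>\<^bsub>class_group s v\<^esub> inv\<^bsub>class_group s v\<^esub> divisor_class s v (frag_of j))"
  proof (cases "Poly_Mapping.lookup e j = 0")
    case True
    then show ?thesis
      by (simp add: graded_piece_def coord_ring_closed)
  next
    case False
    then have split: "e = (e - ?z) + ?z"
      by (intro poly_mapping_eqI) (auto simp: lookup_add lookup_minus lookup_single when_def)
    then have sub: "Poly_Mapping.keys (e - ?z) \<subseteq> {1..s}"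
      using e(1) keys_add_nat[of "e - ?z" ?z] by auto
    then have "\<alpha> = monomial_degree s v (e - ?z) \<otimes>\<^bsub>class_group s v\<^esub> divisor_class s v (frag_of j)"
      using monomial_degree_add[of "e - ?z" s ?z v] split e(2) j
      by (simp add: monomial_degree_single del: One_nat_def)
    then have "\<alpha> \<otimes>\<^bsub>class_group s v\<^esub> inv\<^bsub>class_group s v\<^esub> divisor_class s v (frag_of j)
        = monomial_degree s v (e - ?z)"
      using monomial_degree_closed[OF sub, of v] divisor_class_closed[of "frag_of j" s v] j
      by (simp add: m_assoc)
    then show ?thesis
      using sub by (auto simp: graded_piece_def carrier_coord_ring_iff)
  qed
qed

section \<open>Syzygies of a regular sequence\<close>

text \<open>
  Induction on the length. In a syzygy \<open>y\<close> the last coefficient satisfies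
  \<open>x\<^sub>m y\<^sub>m \<in> (x\<^sub>1, \<dots>, x\<^sub>m\<^sub>-\<^sub>1)\<close>, so regularity gives \<open>y\<^sub>m = \<Sum> d\<^sub>j x\<^sub>j\<close> over \<open>j < m\<close>. Subtracting the
  trivial relations between \<open>x\<^sub>j\<close> and \<open>x\<^sub>m\<close> with coefficients \<open>d\<^sub>j\<close> removes the last entry and leaves
  a syzygy of the shorter sequence. The set \<open>C\<close> stands for a ring inside the ambient
  type: regularity in that ring yields coefficients from it, which may be fed back into
  regularity. The antisymmetric matrix of Koszul coefficients is stored by its entries \<open>Q j l\<close> with \<open>j < l\<close>.
\<close>

lemma koszul_syzygy:
  fixes x y :: "nat \<Rightarrow> 'a::comm_ring_1"
  assumes C: "\<And>p q. p \<in> C \<Longrightarrow> q \<in> C \<Longrightarrow> p + q \<in> C"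
      "\<And>p q. p \<in> C \<Longrightarrow> q \<in> C \<Longrightarrow> p * q \<in> C" "\<And>p. p \<in> C \<Longrightarrow> - p \<in> C"
    and x: "\<And>j. j \<in> {1..k} \<Longrightarrow> x j \<in> C"
    and regular: "\<And>l c z. l \<in> {1..k} \<Longrightarrow> z \<in> C \<Longrightarrow> \<forall>j\<in>{1..<l}. c j \<in> C \<Longrightarrow>
      x l * z = (\<Sum>j=1..<l. c j * x j) \<Longrightarrow>
      \<exists>d. (\<forall>j\<in>{1..<l}. d j \<in> C) \<and> z = (\<Sum>j=1..<l. d j * x j)"
    and y: "\<And>j. j \<in> {1..k} \<Longrightarrow> y j \<in> C"
    and syzygy: "(\<Sum>j=1..k. y j * x j) = 0"
  shows "\<exists>Q. (\<forall>l\<in>{1..k}. \<forall>j\<in>{1..<l}. Q j l \<in> C) \<and>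
    (\<forall>j\<in>{1..k}. y j = (\<Sum>l\<in>{1..<j}. Q l j * x l) - (\<Sum>l\<in>{j<..k}. Q j l * x l))"
  using x regular y syzygy
proof (induction k arbitrary: y)
  case 0
  then show ?case
    by simp
next
  case (Suc k)
  let ?m = "Suc k"
  have rel: "x ?m * y ?m = (\<Sum>j=1..<?m. - y j * x j)"
    using Suc.prems(4)
    by (simp add: sum_negf atLeastLessThanSuc_atLeastAtMost eq_neg_iff_add_eq_0 algebra_simps)
  obtain d where d: "\<forall>j\<in>{1..<?m}. d j \<in> C" and y_last: "y ?m = (\<Sum>j=1..<?m. d j * x j)"
    using Suc.prems(2)[OF _ _ _ rel] Suc.prems(3) C(3) by auto
  \<comment> \<open>What remains of the first \<open>k\<close> entries once the last one has been eliminated.\<close>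
  define y' where "y' = (\<lambda>j. y j + d j * x ?m)"
  have "(\<Sum>j=1..k. y' j * x j) = (\<Sum>j=1..k. y j * x j) + x ?m * y ?m"
    unfolding y'_def y_last
    by (simp add: atLeastLessThanSuc_atLeastAtMost sum_distrib_left sum.distrib algebra_simps)
  also have "\<dots> = 0"
    using Suc.prems(4) by (simp add: mult.commute)
  finally have syz: "(\<Sum>j=1..k. y' j * x j) = 0" .
  have y': "y' j \<in> C" if "j \<in> {1..k}" for j
    unfolding y'_def using that Suc.prems(1,3) d C by simp
  have "\<exists>Q. (\<forall>l\<in>{1..k}. \<forall>j\<in>{1..<l}. Q j l \<in> C) \<and>
      (\<forall>j\<in>{1..k}. y' j = (\<Sum>l\<in>{1..<j}. Q l j * x l) - (\<Sum>l\<in>{j<..k}. Q j l * x l))"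
  proof (rule Suc.IH[OF _ _ y' syz])
    show "x j \<in> C" if "j \<in> {1..k}" for j
      using Suc.prems(1) that by simp
    show "\<exists>d. (\<forall>j\<in>{1..<l}. d j \<in> C) \<and> z = (\<Sum>j=1..<l. d j * x j)"
      if "l \<in> {1..k}" "z \<in> C" "\<forall>j\<in>{1..<l}. c j \<in> C" "x l * z = (\<Sum>j=1..<l. c j * x j)" for l c z
      using Suc.prems(2)[of l z c] that by simp
  qed
  then obtain Q where Q: "\<forall>l\<in>{1..k}. \<forall>j\<in>{1..<l}. Q j l \<in> C"
      "\<forall>j\<in>{1..k}. y' j = (\<Sum>l\<in>{1..<j}. Q l j * x l) - (\<Sum>l\<in>{j<..k}. Q j l * x l)"
    by blast
  define Q' where "Q' = (\<lambda>j l. if l = ?m then d j else Q j l)"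
  have "\<forall>l\<in>{1..?m}. \<forall>j\<in>{1..<l}. Q' j l \<in> C"
    using Q(1) d by (auto simp: Q'_def le_Suc_eq)
  moreover have "y j = (\<Sum>l\<in>{1..<j}. Q' l j * x l) - (\<Sum>l\<in>{j<..?m}. Q' j l * x l)"
    if j: "j \<in> {1..?m}" for j
  proof (cases "j = ?m")
    case True
    then show ?thesis
      by (simp add: Q'_def y_last)
  next
    case False
    with j have jk: "j \<in> {1..k}"
      by auto
    then have "{j<..?m} = insert ?m {j<..k}"
      by auto
    then have "(\<Sum>l\<in>{j<..?m}. Q' j l * x l) = d j * x ?m + (\<Sum>l\<in>{j<..k}. Q j l * x l)"
      by (auto simp: Q'_def intro!: sum.cong)
    moreover have "(\<Sum>l\<in>{1..<j}. Q' l j * x l) = (\<Sum>l\<in>{1..<j}. Q l j * x l)"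
      using False by (simp add: Q'_def)
    ultimately show ?thesis
      using bspec[OF Q(2) jk] by (simp add: y'_def algebra_simps)
  qed
  ultimately show ?case
    by blast
qed

lemma regular_sequence_coord_ring:
  assumes reg: "regular_sequence (coord_ring s) (map x [1..<Suc k])"
    and l: "l \<in> {1..k}" and z: "z \<in> carrier (coord_ring s)"
    and c: "\<forall>j\<in>{1..<l}. c j \<in> carrier (coord_ring s)"
    and eq: "x l * z = (\<Sum>j=1..<l. c j * x j)"
  shows "\<exists>d. (\<forall>j\<in>{1..<l}. d j \<in> carrier (coord_ring s)) \<and> z = (\<Sum>j=1..<l. d j * x j)"
proof -
  let ?fs = "map x [1..<Suc k]"
  have "x ` {1..<Suc k} \<subseteq> carrier (coord_ring s)"
    using reg unfolding regular_sequence_def by (simp del: upt_Suc)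
  with l have x: "x j \<in> carrier (coord_ring s)" if "j \<in> {1..<l}" for j
    using that by (auto simp: image_subset_iff)
  have "set (take (l - 1) ?fs) = x ` {1..<l}"
    using l by (simp add: take_map take_upt del: upt_Suc)
  then have idl: "Idl\<^bsub>coord_ring s\<^esub> (set (take (l - 1) ?fs)) =
      {\<Sum>j=1..<l. c j * x j | c. \<forall>j\<in>{1..<l}. c j \<in> carrier (coord_ring s)}"
    using genideal_coord_ring[OF _ x, of "{1..<l}"] by simp
  have nth: "?fs ! (l - 1) = x l" "l - 1 < length ?fs"
    using l by (auto simp del: upt_Suc)
  have "x l * z \<in> Idl\<^bsub>coord_ring s\<^esub> (set (take (l - 1) ?fs))"
    unfolding idl using c eq by blast
  then have "z \<in> Idl\<^bsub>coord_ring s\<^esub> (set (take (l - 1) ?fs))"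
    using reg nth z unfolding regular_sequence_def coord_ring_simps by metis
  then show ?thesis
    unfolding idl by blast
qed

text \<open>
  A syzygy is homogeneous of degree \<open>\<epsilon>\<close> when each product \<open>y j * x j\<close> is. Its Koszul coefficients
  \<open>Q j l\<close> then have the expected degree \<open>\<epsilon> - \<xi> j - \<xi> l\<close>, and their components in these degrees
  already satisfy the required equations.
\<close>

lemma graded_koszul_syzygy:
  assumes reg: "regular_sequence (coord_ring s) (map x [1..<Suc k])"
    and \<epsilon>: "\<epsilon> \<in> carrier (class_group s v)"
    and \<xi>: "\<And>j. j \<in> {1..k} \<Longrightarrow> \<xi> j \<in> carrier (class_group s v)"
    and x: "\<And>j. j \<in> {1..k} \<Longrightarrow> x j \<in> graded_piece s v (\<xi> j)"
    and y: "\<And>j. j \<in> {1..k} \<Longrightarrow>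
      y j \<in> graded_piece s v (\<epsilon> \<otimes>\<^bsub>class_group s v\<^esub> inv\<^bsub>class_group s v\<^esub> \<xi> j)"
    and syzygy: "(\<Sum>j=1..k. y j * x j) = 0"
  shows "\<exists>Q. (\<forall>l\<in>{1..k}. \<forall>j\<in>{1..<l}. quasi_homogeneous s v (Q j l)) \<and>
    (\<forall>j\<in>{1..k}. y j = (\<Sum>l\<in>{1..<j}. Q l j * x l) - (\<Sum>l\<in>{j<..k}. Q j l * x l))"
proof -
  interpret comm_group "class_group s v" by (rule comm_group_class_group)
  let ?C = "carrier (coord_ring s)"
  let ?deg = "\<lambda>j l. \<epsilon> \<otimes>\<^bsub>class_group s v\<^esub> inv\<^bsub>class_group s v\<^esub> \<xi> j
    \<otimes>\<^bsub>class_group s v\<^esub> inv\<^bsub>class_group s v\<^esub> \<xi> l"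
  have "\<exists>Q. (\<forall>l\<in>{1..k}. \<forall>j\<in>{1..<l}. Q j l \<in> ?C) \<and>
    (\<forall>j\<in>{1..k}. y j = (\<Sum>l\<in>{1..<j}. Q l j * x l) - (\<Sum>l\<in>{j<..k}. Q j l * x l))"
    using x y
    by (intro koszul_syzygy syzygy regular_sequence_coord_ring[OF reg] coord_ring_closed)
      (auto simp: graded_piece_def)
  then obtain Q where Q: "\<And>j l. l \<in> {1..k} \<Longrightarrow> j \<in> {1..<l} \<Longrightarrow> Q j l \<in> ?C"
    and y_eq: "\<And>j. j \<in> {1..k} \<Longrightarrow> y j = (\<Sum>l\<in>{1..<j}. Q l j * x l) - (\<Sum>l\<in>{j<..k}. Q j l * x l)"
    by blast
  define Q' where "Q' = (\<lambda>j l. homogeneous_part s v (?deg j l) (Q j l))"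
  have "quasi_homogeneous s v (Q' j l)" if "l \<in> {1..k}" "j \<in> {1..<l}" for j l
  proof -
    have "?deg j l \<in> carrier (class_group s v)"
      using that \<epsilon> \<xi> by simp
    then show ?thesis
      unfolding Q'_def quasi_homogeneous_def
      using homogeneous_part_in_graded_piece Q that by blast
  qed
  moreover have "y j = (\<Sum>l\<in>{1..<j}. Q' l j * x l) - (\<Sum>l\<in>{j<..k}. Q' j l * x l)"
    if j: "j \<in> {1..k}" for j
  proof -
    let ?\<gamma> = "\<epsilon> \<otimes>\<^bsub>class_group s v\<^esub> inv\<^bsub>class_group s v\<^esub> \<xi> j"
    have \<gamma>: "?\<gamma> \<in> carrier (class_group s v)"
      using \<epsilon> \<xi> j by simp
    have below: "homogeneous_part s v ?\<gamma> (Q l j * x l) = Q' l j * x l" if "l \<in> {1..<j}" for l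
    proof -
      have l: "l \<in> {1..k}"
        using that j by auto
      then have "?\<gamma> \<otimes>\<^bsub>class_group s v\<^esub> inv\<^bsub>class_group s v\<^esub> \<xi> l = ?deg l j"
        using \<epsilon> \<xi> j by (simp add: m_ac)
      then show ?thesis
        unfolding Q'_def using homogeneous_part_mult[OF Q[OF j that] x[OF l] \<xi>[OF l] \<gamma>] by simp
    qed
    have above: "homogeneous_part s v ?\<gamma> (Q j l * x l) = Q' j l * x l" if "l \<in> {j<..k}" for l
    proof -
      have l: "l \<in> {1..k}" "j \<in> {1..<l}"
        using that j by auto
      show ?thesis
        unfolding Q'_def by (rule homogeneous_part_mult[OF Q[OF l] x[OF l(1)] \<xi>[OF l(1)] \<gamma>])
    qed
    have "y j = homogeneous_part s v ?\<gamma> (y j)"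
      using homogeneous_part_ident[OF y[OF j]] by simp
    also have "\<dots> = (\<Sum>l\<in>{1..<j}. Q' l j * x l) - (\<Sum>l\<in>{j<..k}. Q' j l * x l)"
      unfolding y_eq[OF j] using below above
      by (simp add: homogeneous_part_diff homogeneous_part_sum)
    finally show ?thesis .
  qed
  ultimately show ?thesis
    by blast
qed

section \<open>Vector fields in selected coordinate directions\<close>

lemma vf_sum_coefficient: "(\<Sum>j\<in>J. (F j :: vfield)) l = (\<Sum>j\<in>J. F j l)"
  by (induction J rule: infinite_finite_induct) auto

lemma vf_combination_coefficient:
  fixes k :: nat
  assumes "inj_on i {1..k}"
  shows "(\<Sum>j=1..k. p j \<odot> coord_vf (i j)) l =
    (if l \<in> i ` {1..k} then p (inv_into {1..k} i l) else 0)"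
proof (cases "l \<in> i ` {1..k}")
  case True
  then obtain m where m: "m \<in> {1..k}" "l = i m"
    by blast
  then have "(\<Sum>j=1..k. p j \<odot> coord_vf (i j)) l = (\<Sum>j=1..k. if j = m then p j else 0)"
    unfolding vf_sum_coefficient vf_scale_def coord_vf_def
    using assms by (intro sum.cong) (auto dest: inj_onD)
  then show ?thesis
    using m assms by simp
next
  case False
  then show ?thesis
    by (auto simp: vf_sum_coefficient vf_scale_def coord_vf_def intro!: sum.neutral)
qed

lemma vf_apply_combination:
  fixes k s :: nat
  assumes "inj_on i {1..k}" "i ` {1..k} \<subseteq> {1..s}"
  shows "vf_apply s (\<Sum>j=1..k. p j \<odot> coord_vf (i j)) f = (\<Sum>j=1..k. p j * partial_deriv (i j) f)"
proof -
  have "vf_apply s (\<Sum>j=1..k. p j \<odot> coord_vf (i j)) f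
      = (\<Sum>l\<in>i ` {1..k}. (\<Sum>j=1..k. p j \<odot> coord_vf (i j)) l * partial_deriv l f)"
    unfolding vf_apply_def
    using assms(2) by (intro sum.mono_neutral_right)
      (auto simp: vf_combination_coefficient[OF assms(1)] simp del: One_nat_def)
  also have "\<dots> = (\<Sum>j=1..k. p j * partial_deriv (i j) f)"
    by (subst sum.reindex[OF assms(1)], intro sum.cong)
      (simp_all add: vf_combination_coefficient[OF assms(1)] inv_into_f_f[OF assms(1)] del: One_nat_def)
  finally show ?thesis .
qed

text \<open>
  The coefficient at the direction \<open>i j\<close> receives contributions from the pairs in which \<open>j\<close> is the
  larger index, with a positive sign, and from those in which it is the smaller one, with a
  negative sign.
\<close>

lemma sum_pairs_koszul:
  fixes k :: nat
  assumes p: "\<And>j. j \<in> {1..k} \<Longrightarrow> p j = (\<Sum>l\<in>{1..<j}. Q l j * x l) - (\<Sum>l\<in>{j<..k}. Q j l * x l)"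
  shows "(\<Sum>(j\<^sub>1, j\<^sub>2)\<in>{(j\<^sub>1, j\<^sub>2). 1 \<le> j\<^sub>1 \<and> j\<^sub>1 < j\<^sub>2 \<and> j\<^sub>2 \<le> k}.
      Q j\<^sub>1 j\<^sub>2 \<odot> (x j\<^sub>1 \<odot> coord_vf (i j\<^sub>2) - x j\<^sub>2 \<odot> coord_vf (i j\<^sub>1)))
    = (\<Sum>j=1..k. p j \<odot> coord_vf (i j))"
proof
  fix m
  let ?T = "{(j\<^sub>1, j\<^sub>2). 1 \<le> j\<^sub>1 \<and> j\<^sub>1 < j\<^sub>2 \<and> j\<^sub>2 \<le> k}"
  let ?e = "\<lambda>j. coord_vf (i j) m"
  have T1: "?T = Sigma {1..k} (\<lambda>j\<^sub>1. {j\<^sub>1<..k})"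
    by auto
  have "(\<Sum>(j\<^sub>1, j\<^sub>2)\<in>?T. Q j\<^sub>1 j\<^sub>2 * x j\<^sub>2 * ?e j\<^sub>1) = (\<Sum>j=1..k. (\<Sum>l\<in>{j<..k}. Q j l * x l) * ?e j)"
    unfolding T1 by (subst sum.Sigma[symmetric]) (auto simp: sum_distrib_right)
  moreover have "(\<Sum>(j\<^sub>1, j\<^sub>2)\<in>?T. Q j\<^sub>1 j\<^sub>2 * x j\<^sub>1 * ?e j\<^sub>2) = (\<Sum>j=1..k. (\<Sum>l\<in>{1..<j}. Q l j * x l) * ?e j)"
  proof -
    have "(\<Sum>(j\<^sub>1, j\<^sub>2)\<in>?T. Q j\<^sub>1 j\<^sub>2 * x j\<^sub>1 * ?e j\<^sub>2)
        = (\<Sum>(j, l)\<in>Sigma {1..k} (\<lambda>j. {1..<j}). Q l j * x l * ?e j)"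
      by (rule sum.reindex_bij_witness[of _ "\<lambda>(a, b). (b, a)" "\<lambda>(a, b). (b, a)"]) auto
    then show ?thesis
      by (subst (asm) sum.Sigma[symmetric]) (auto simp: sum_distrib_right)
  qed
  moreover have "(\<Sum>j=1..k. p j \<odot> coord_vf (i j)) m
      = (\<Sum>j=1..k. (\<Sum>l\<in>{1..<j}. Q l j * x l) * ?e j) - (\<Sum>j=1..k. (\<Sum>l\<in>{j<..k}. Q j l * x l) * ?e j)"
    by (simp add: vf_sum_coefficient vf_scale_def p left_diff_distrib sum_subtractf)
  moreover have "(\<Sum>(j\<^sub>1, j\<^sub>2)\<in>?T.
      Q j\<^sub>1 j\<^sub>2 \<odot> (x j\<^sub>1 \<odot> coord_vf (i j\<^sub>2) - x j\<^sub>2 \<odot> coord_vf (i j\<^sub>1))) m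
    = (\<Sum>(j\<^sub>1, j\<^sub>2)\<in>?T. Q j\<^sub>1 j\<^sub>2 * x j\<^sub>1 * ?e j\<^sub>2) - (\<Sum>(j\<^sub>1, j\<^sub>2)\<in>?T. Q j\<^sub>1 j\<^sub>2 * x j\<^sub>2 * ?e j\<^sub>1)"
    unfolding vf_sum_coefficient sum_subtractf[symmetric]
    by (intro sum.cong) (auto simp: vf_scale_def algebra_simps)
  ultimately show "(\<Sum>(j\<^sub>1, j\<^sub>2)\<in>?T.
      Q j\<^sub>1 j\<^sub>2 \<odot> (x j\<^sub>1 \<odot> coord_vf (i j\<^sub>2) - x j\<^sub>2 \<odot> coord_vf (i j\<^sub>1))) m
    = (\<Sum>j=1..k. p j \<odot> coord_vf (i j)) m"
    by simp
qed

section \<open>The decomposition of an invariant vector field\<close>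

theorem theorem4p3:
  fixes \<Delta> :: "(real ^ 'n) set set"
    and n r k :: nat
    and \<rho> :: "nat \<Rightarrow> (real ^ 'n) set"
    and v :: "nat \<Rightarrow> int ^ 'n"
    and \<alpha> \<delta> :: "(nat \<Rightarrow>\<^sub>0 int) set"
    and f :: cpoly
    and i :: "nat \<Rightarrow> nat"
    and a :: "nat \<Rightarrow> complex"
    and \<theta> :: "(nat \<Rightarrow>\<^sub>0 int) set \<Rightarrow> complex"
    and R X X\<^sub>1 X\<^sub>2 :: vfield
    and P :: "nat \<Rightarrow> cpoly"
  assumes dimension: "n = CARD('n)"
    and fan: "complete_fan \<Delta>" "simplicial_fan \<Delta>"
    and rays: "ray_enumeration \<Delta> (n + r) \<rho> v"
    and degree: "\<alpha> \<in> carrier (class_group (n + r) v)" "f \<in> graded_piece (n + r) v \<alpha>" "f \<noteq> 0"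
    and quasi_smooth: "quasi_smooth \<Delta> (n + r) \<rho> f"
    and indices: "1 \<le> k" "strict_mono_on {1..k} i" "i ` {1..k} \<subseteq> {1..n + r}"
    and regular: "regular_sequence (coord_ring (n + r)) (map (\<lambda>j. partial_deriv (i j) f) [1..<Suc k])"
    and radial: "radial_vf (n + r) v R"
      "R = (\<Sum>j=1..k. (const_poly (a (i j)) * zvar (i j)) \<odot> coord_vf (i j))"
    and euler: "vf_apply (n + r) R f = const_poly (\<theta> \<alpha>) * f" "\<theta> \<alpha> \<noteq> 0"
    and field: "\<delta> \<in> carrier (class_group (n + r) v)" "quasi_homogeneous_vf (n + r) v \<delta> X"
    and decomposition: "X = X\<^sub>1 + X\<^sub>2" "quasi_homogeneous_vf (n + r) v \<delta> X\<^sub>1"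
      "X\<^sub>1 = (\<Sum>j=1..k. P (i j) \<odot> coord_vf (i j))"
    and invariant: "leaves_invariant (n + r) v f X\<^sub>1"
  shows "\<exists>Q g.
    (\<forall>j\<^sub>1 j\<^sub>2. 1 \<le> j\<^sub>1 \<and> j\<^sub>1 < j\<^sub>2 \<and> j\<^sub>2 \<le> k \<longrightarrow> quasi_homogeneous (n + r) v (Q j\<^sub>1 j\<^sub>2)) \<and>
    quasi_homogeneous (n + r) v g \<and>
    X\<^sub>1 =
      (\<Sum>(j\<^sub>1, j\<^sub>2)\<in>{(j\<^sub>1, j\<^sub>2). 1 \<le> j\<^sub>1 \<and> j\<^sub>1 < j\<^sub>2 \<and> j\<^sub>2 \<le> k}.
         Q j\<^sub>1 j\<^sub>2 \<odot> (partial_deriv (i j\<^sub>1) f \<odot> coord_vf (i j\<^sub>2)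
                  - partial_deriv (i j\<^sub>2) f \<odot> coord_vf (i j\<^sub>1)))
      + (const_poly (1 / \<theta> \<alpha>) * g) \<odot>
          (\<Sum>j=1..k. (const_poly (a (i j)) * zvar (i j)) \<odot> coord_vf (i j))"
proof -
  let ?s = "n + r"
  interpret comm_group "class_group ?s v" by (rule comm_group_class_group)
  define D where "D = (\<lambda>j. divisor_class ?s v (frag_of (i j)))"
  define x where "x = (\<lambda>j. partial_deriv (i j) f)"
  define \<xi> where "\<xi> = (\<lambda>j. \<alpha> \<otimes>\<^bsub>class_group ?s v\<^esub> inv\<^bsub>class_group ?s v\<^esub> D j)"
  define \<epsilon> where "\<epsilon> = \<delta> \<otimes>\<^bsub>class_group ?s v\<^esub> \<alpha>"
  define z where "z = (\<lambda>j. const_poly (a (i j)) * zvar (i j))"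
  have inj: "inj_on i {1..k}"
    using indices(2) by (rule strict_mono_on_imp_inj_on)
  have i: "i j \<in> {1..?s}" if "j \<in> {1..k}" for j
    using that indices(3) by blast
  have \<epsilon>: "\<epsilon> \<in> carrier (class_group ?s v)"
    using degree(1) field(1) by (simp add: \<epsilon>_def)
  have D: "D j \<in> carrier (class_group ?s v)" if "j \<in> {1..k}" for j
    unfolding D_def by (rule divisor_class_closed) (use i[OF that] in simp)
  have \<xi>: "\<xi> j \<in> carrier (class_group ?s v)" if "j \<in> {1..k}" for j
    using D[OF that] degree(1) by (simp add: \<xi>_def)
  have x: "x j \<in> graded_piece ?s v (\<xi> j)" if "j \<in> {1..k}" for j
    unfolding x_def \<xi>_def D_def by (rule partial_deriv_in_graded_piece[OF degree(2) i[OF that]])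
  have degree_coeff: "\<epsilon> \<otimes>\<^bsub>class_group ?s v\<^esub> inv\<^bsub>class_group ?s v\<^esub> \<xi> j = \<delta> \<otimes>\<^bsub>class_group ?s v\<^esub> D j"
    if "j \<in> {1..k}" for j
    using D[OF that] degree(1) field(1)
    by (simp add: \<epsilon>_def \<xi>_def inv_mult m_assoc) (simp flip: m_assoc)
  have P: "P (i j) \<in> graded_piece ?s v (\<delta> \<otimes>\<^bsub>class_group ?s v\<^esub> D j)" if j: "j \<in> {1..k}" for j
  proof -
    have "X\<^sub>1 (i j) = P (i j)"
      unfolding decomposition(3) vf_combination_coefficient[OF inj, of "\<lambda>j. P (i j)"]
      using j by (simp add: inv_into_f_f[OF inj] del: One_nat_def)
    then show ?thesis
      using decomposition(2) i[OF j] unfolding quasi_homogeneous_vf_def D_def by metis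
  qed
  have X1_f: "vf_apply ?s X\<^sub>1 f = (\<Sum>j=1..k. P (i j) * x j)"
    unfolding decomposition(3) x_def by (rule vf_apply_combination[OF inj indices(3)])
  have R_f: "(\<Sum>j=1..k. z j * x j) = const_poly (\<theta> \<alpha>) * f"
    using euler(1) vf_apply_combination[OF inj indices(3), of z f]
    by (simp add: radial(2) x_def z_def)
  obtain g\<^sub>0 where g\<^sub>0: "quasi_homogeneous ?s v g\<^sub>0" "vf_apply ?s X\<^sub>1 f = g\<^sub>0 * f"
    using invariant by (auto simp: leaves_invariant_def)
  then have g\<^sub>0_closed: "g\<^sub>0 \<in> carrier (coord_ring ?s)"
    by (auto simp: quasi_homogeneous_def graded_piece_def)

  \<comment> \<open>As \<open>X\<^sub>1(f)\<close> has degree \<open>\<delta> + \<alpha>\<close> and \<open>f\<close> has degree \<open>\<alpha>\<close>, only the component of degree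
    \<open>\<delta>\<close> of \<open>g\<^sub>0\<close> contributes to \<open>g\<^sub>0 * f\<close>.\<close>
  define g where "g = homogeneous_part ?s v \<delta> g\<^sub>0"
  have g: "g \<in> graded_piece ?s v \<delta>"
    unfolding g_def by (rule homogeneous_part_in_graded_piece[OF g\<^sub>0_closed])
  have "vf_apply ?s X\<^sub>1 f \<in> graded_piece ?s v \<epsilon>"
    unfolding X1_f
  proof (rule graded_piece_sum)
    fix j assume j: "j \<in> {1..k}"
    have "(\<delta> \<otimes>\<^bsub>class_group ?s v\<^esub> D j) \<otimes>\<^bsub>class_group ?s v\<^esub> \<xi> j = \<epsilon>"
      using \<xi>[OF j] \<epsilon> by (simp add: degree_coeff[OF j, symmetric] m_assoc)
    then show "P (i j) * x j \<in> graded_piece ?s v \<epsilon>"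
      using graded_piece_mult[OF P[OF j] x[OF j]] by simp
  qed
  then have "g\<^sub>0 * f = homogeneous_part ?s v \<epsilon> (g\<^sub>0 * f)"
    by (simp add: g\<^sub>0(2) homogeneous_part_ident)
  also have "\<dots> = g * f"
    using homogeneous_part_mult[OF g\<^sub>0_closed degree(2,1) \<epsilon>] degree(1) field(1)
    by (simp add: g_def \<epsilon>_def m_assoc)
  finally have X1_f_g: "(\<Sum>j=1..k. P (i j) * x j) = g * f"
    using X1_f g\<^sub>0(2) by metis

  define c where "c = const_poly (1 / \<theta> \<alpha>)"
  have c: "c * const_poly (\<theta> \<alpha>) = 1"
    using euler(2) by (simp add: c_def const_poly_def mult_single)
  define y where "y = (\<lambda>j. P (i j) - c * g * z j)"
  have y: "y j \<in> graded_piece ?s v (\<epsilon> \<otimes>\<^bsub>class_group ?s v\<^esub> inv\<^bsub>class_group ?s v\<^esub> \<xi> j)"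
    if j: "j \<in> {1..k}" for j
  proof -
    have "z j \<in> graded_piece ?s v (D j)"
      unfolding z_def D_def by (intro graded_piece_const_mult zvar_in_graded_piece i[OF j])
    then have "c * (g * z j) \<in> graded_piece ?s v (\<delta> \<otimes>\<^bsub>class_group ?s v\<^esub> D j)"
      unfolding c_def by (intro graded_piece_const_mult graded_piece_mult g)
    then show ?thesis
      unfolding y_def degree_coeff[OF j] mult.assoc by (intro graded_piece_diff P[OF j])
  qed
  have "(\<Sum>j=1..k. y j * x j) = (\<Sum>j=1..k. P (i j) * x j) - c * g * (\<Sum>j=1..k. z j * x j)"
    by (simp add: y_def left_diff_distrib sum_subtractf sum_distrib_left mult.assoc)
  also have "\<dots> = g * f - (c * const_poly (\<theta> \<alpha>)) * (g * f)"
    unfolding X1_f_g R_f by (simp add: ac_simps)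
  also have "\<dots> = 0"
    by (simp add: c)
  finally have syzygy: "(\<Sum>j=1..k. y j * x j) = 0" .
  have reg: "regular_sequence (coord_ring ?s) (map x [1..<Suc k])"
    using regular by (simp only: x_def)
  obtain Q where Q: "\<forall>l\<in>{1..k}. \<forall>j\<in>{1..<l}. quasi_homogeneous ?s v (Q j l)"
    and y_eq: "\<forall>j\<in>{1..k}. y j = (\<Sum>l\<in>{1..<j}. Q l j * x l) - (\<Sum>l\<in>{j<..k}. Q j l * x l)"
    using graded_koszul_syzygy[OF reg \<epsilon> \<xi> x y syzygy] by blast

  have "X\<^sub>1 = (\<Sum>j=1..k. y j \<odot> coord_vf (i j)) + (c * g) \<odot> (\<Sum>j=1..k. z j \<odot> coord_vf (i j))"
  proof
    fix m
    show "X\<^sub>1 m = ((\<Sum>j=1..k. y j \<odot> coord_vf (i j)) + (c * g) \<odot> (\<Sum>j=1..k. z j \<odot> coord_vf (i j))) m"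
      unfolding decomposition(3) plus_fun_def vf_scale_def vf_sum_coefficient sum_distrib_left
        sum.distrib[symmetric]
      by (intro sum.cong) (simp_all add: y_def algebra_simps)
  qed
  also have "(\<Sum>j=1..k. y j \<odot> coord_vf (i j)) =
      (\<Sum>(j\<^sub>1, j\<^sub>2)\<in>{(j\<^sub>1, j\<^sub>2). 1 \<le> j\<^sub>1 \<and> j\<^sub>1 < j\<^sub>2 \<and> j\<^sub>2 \<le> k}.
         Q j\<^sub>1 j\<^sub>2 \<odot> (x j\<^sub>1 \<odot> coord_vf (i j\<^sub>2) - x j\<^sub>2 \<odot> coord_vf (i j\<^sub>1)))"
    using y_eq by (intro sum_pairs_koszul[symmetric]) blast
  finally have X1_eq: "X\<^sub>1 =
      (\<Sum>(j\<^sub>1, j\<^sub>2)\<in>{(j\<^sub>1, j\<^sub>2). 1 \<le> j\<^sub>1 \<and> j\<^sub>1 < j\<^sub>2 \<and> j\<^sub>2 \<le> k}.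
         Q j\<^sub>1 j\<^sub>2 \<odot> (x j\<^sub>1 \<odot> coord_vf (i j\<^sub>2) - x j\<^sub>2 \<odot> coord_vf (i j\<^sub>1)))
      + (c * g) \<odot> (\<Sum>j=1..k. z j \<odot> coord_vf (i j))" .
  have "quasi_homogeneous ?s v g"
    using g field(1) by (auto simp: quasi_homogeneous_def)
  moreover have "\<forall>j\<^sub>1 j\<^sub>2. 1 \<le> j\<^sub>1 \<and> j\<^sub>1 < j\<^sub>2 \<and> j\<^sub>2 \<le> k \<longrightarrow> quasi_homogeneous ?s v (Q j\<^sub>1 j\<^sub>2)"
    using Q by auto
  ultimately show ?thesis
    using X1_eq unfolding x_def c_def z_def by blast
qed

end
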